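(* Let $\alpha$ and $\beta$ be integers. If there exists an extremal singly even self-dual $[90,45,16]$ code $C$ whose shadow has minimum weight at least $9$, with weight enumerator \[ W_{90} = 1 + (9180 + 8 \beta)y^{16} + (-512 \alpha - 24 \beta +224360)y^{18} + \cdots \] and shadow weight enumerator \[ S_{90} = \alpha y^9 + (\beta -18 \alpha) y^{13} +(112320 + 153 \alpha -16\beta)y^{17} + \cdots, \] then $0 \le \alpha \le 76$.
   Context: All codes are binary linear codes; an $[n,k,d]$ code has length $n$, dimension $k$ and minimum nonzero weight $d$. A code $C$ is self-dual if $C=C^\perp$ with respect to the standard inner product; a self-dual code is singly even if it contains a codeword of weight $\equiv 2 \pmod 4$. For a singly even self-dual code $C$, let $C_0$ be the subcode of codewords of weight $\equiv 0 \pmod 4$. The shadow of $C$ is $S=C_0^\perp\setminus C$. The weight enumerators of $C$ and $S$ are $\sum_i A_i y^i$ and $\sum_i B_i y^i$, where $A_i$ and $B_i$ are the numbers of vectors of weight $i$ in $C$ and $S$ respectively; the dots denote terms of higher degree. Extremal means meeting the upper bound on the minimum weight of self-dual codes of the given length: $d\le 4\lfloor n/24\rfloor+6$ if $n\equiv 22\pmod{24}$ and $d\le 4\lfloor n/24\rfloor+4$ otherwise; for $n=90$ this is $d=16$. Known (Dougherty–Gulliver–Harada): every singly even self-dual $[90,45,16]$ code whose shadow has minimum weight at least $9$ has weight enumerators of the stated form for some integers $\alpha,\beta$ with $0\le\alpha\le\frac{1}{18}\beta\le\lfloor\frac{224360}{24}\rfloor=9348$. *)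

theory Defs
  imports
    "HOL-Analysis.Cartesian_Space"
    "HOL-Library.Z2"
    "HOL-Computational_Algebra.Polynomial"
begin

type_synonym 'n binary_vector = "bit ^ 'n"

definition weight :: "'n::finite binary_vector \<Rightarrow> nat" where
  "weight v = card {i. v $ i \<noteq> 0}"

(* The nonzero condition matters for linear codes only: a shadow never contains 0.
   The value is meaningful only if the set has a nonzero element. *)
definition min_weight :: "'n::finite binary_vector set \<Rightarrow> nat" where
  "min_weight A = Min (weight ` (A - {0}))"

definition linear_code :: "nat \<Rightarrow> nat \<Rightarrow> nat \<Rightarrow> 'n::finite binary_vector set \<Rightarrow> bool" where
  "linear_code n k d C \<longleftrightarrow>
     CARD('n) = n \<and> vec.subspace C \<and> vec.dim C = k \<and> min_weight C = d"

definition dual_code :: "'n::finite binary_vector set \<Rightarrow> 'n binary_vector set" where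
  "dual_code C = {v. \<forall>c\<in>C. (\<Sum>i\<in>UNIV. v $ i * c $ i) = 0}"

definition self_dual :: "'n::finite binary_vector set \<Rightarrow> bool" where
  "self_dual C \<longleftrightarrow> C = dual_code C"

definition singly_even_self_dual :: "'n::finite binary_vector set \<Rightarrow> bool" where
  "singly_even_self_dual C \<longleftrightarrow> self_dual C \<and> (\<exists>c\<in>C. weight c mod 4 = 2)"

definition doubly_even_subcode :: "'n::finite binary_vector set \<Rightarrow> 'n binary_vector set" where
  "doubly_even_subcode C = {c \<in> C. weight c mod 4 = 0}"

definition shadow :: "'n::finite binary_vector set \<Rightarrow> 'n binary_vector set" where
  "shadow C = dual_code (doubly_even_subcode C) - C"

definition self_dual_bound :: "nat \<Rightarrow> nat" where
  "self_dual_bound n =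
     (if n mod 24 = 22 then 4 * (n div 24) + 6 else 4 * (n div 24) + 4)"

definition extremal :: "'n::finite binary_vector set \<Rightarrow> bool" where
  "extremal C \<longleftrightarrow> self_dual C \<and> min_weight C = self_dual_bound CARD('n)"

definition weight_enumerator :: "'n::finite binary_vector set \<Rightarrow> int poly" where
  "weight_enumerator A = (\<Sum>i\<le>CARD('n). monom (int (card {v \<in> A. weight v = i})) i)"

end

theory Submission
  imports Defs "HOL-Analysis.Convex"
begin

text \<open>
  Two vectors of weight 9 in the shadow add up to a codeword, which has weight at least 16 if the
  vectors are distinct; so their supports meet in at most one point, and they meet in exactly one
  point iff the sum is doubly even. Hence the supports split into two families of 9-sets: any two
  members of the same family meet in exactly one point, and members of different families are
  disjoint. Such a family has at most \<open>9\<^sup>2 - 9 + 1 = 73\<close> members unless it is a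
  sunflower (Deza), in which case it has at most 11. By Cauchy-Schwarz, 39 members cover at least
  68 points and 4 members cover at least 27. As only 90 points are available, either both families
  have at most 38 members, or one of them has at most 73 and the other at most 3.
\<close>

section \<open>Uniform families with pairwise intersections of size one\<close>

definition one_intersecting :: "nat \<Rightarrow> 'a set set \<Rightarrow> bool" where
  "one_intersecting k F \<longleftrightarrow>
     finite F \<and> (\<forall>B\<in>F. finite B \<and> card B = k) \<and>
     (\<forall>A\<in>F. \<forall>B\<in>F. A \<noteq> B \<longrightarrow> card (A \<inter> B) = 1)"

lemma one_intersecting_meet_unique:
  assumes "one_intersecting k F" "A \<in> F" "B \<in> F" "A \<noteq> B"
    and "x \<in> A" "x \<in> B" "y \<in> A" "y \<in> B"
  shows "x = y"
proof -
  have "card (A \<inter> B) = 1"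
    using assms unfolding one_intersecting_def by blast
  then obtain z where "A \<inter> B = {z}"
    by (rule card_1_singletonE)
  moreover have "x \<in> A \<inter> B" "y \<in> A \<inter> B"
    using assms by auto
  ultimately show ?thesis
    by simp
qed

lemma one_intersecting_meet_ex:
  assumes "one_intersecting k F" "A \<in> F" "B \<in> F" "A \<noteq> B"
  obtains x where "x \<in> A" "x \<in> B"
proof -
  have "card (A \<inter> B) = 1"
    using assms unfolding one_intersecting_def by blast
  then have "A \<inter> B \<noteq> {}"
    by auto
  then show ?thesis
    using that by blast
qed

text \<open>Since two members share only \<open>x\<close>, deleting \<open>x\<close> leaves pairwise
  disjoint sets with \<open>k - 1\<close> points each.\<close>

lemma one_intersecting_sunflower_card:
  assumes F: "one_intersecting k F" and x: "\<And>B. B \<in> F \<Longrightarrow> x \<in> B"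
  shows "card F * (k - 1) \<le> card (\<Union>F)"
proof -
  have fin: "finite F" "\<And>B. B \<in> F \<Longrightarrow> finite B \<and> card B = k"
    using F unfolding one_intersecting_def by auto
  have "card F * (k - 1) = (\<Sum>B\<in>F. card (B - {x}))"
    using fin x by simp
  also have "\<dots> = card (\<Union>B\<in>F. B - {x})"
  proof (rule card_UN_disjoint[symmetric])
    show "\<forall>A\<in>F. \<forall>B\<in>F. A \<noteq> B \<longrightarrow> (A - {x}) \<inter> (B - {x}) = {}"
    proof (intro ballI impI equals0I)
      fix A B y assume *: "A \<in> F" "B \<in> F" "A \<noteq> B" "y \<in> (A - {x}) \<inter> (B - {x})"
      then have "y = x"
        using x by (intro one_intersecting_meet_unique[OF F *(1-3)]) auto
      then show False
        using * by simp
    qed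
  qed (use fin in auto)
  also have "\<dots> \<le> card (\<Union>F)"
    using fin by (intro card_mono) auto
  finally show ?thesis .
qed

text \<open>Each member through \<open>x\<close> meets \<open>A\<close> in a point, and this point
  determines the member: two members sharing it would also share \<open>x\<close>, which lies
  outside \<open>A\<close>. So there are at most as many such members as points of
  \<open>A\<close>.\<close>

lemma one_intersecting_degree_le:
  assumes F: "one_intersecting k F" and A: "A \<in> F" "x \<notin> A"
  shows "card {B \<in> F. x \<in> B} \<le> k"
proof -
  define f where "f B = (SOME y. y \<in> A \<and> y \<in> B)" for B
  have f: "f B \<in> A \<and> f B \<in> B" if "B \<in> F" "x \<in> B" for B
  proof -
    have "A \<noteq> B"
      using that A by blast
    then have "\<exists>y. y \<in> A \<and> y \<in> B"
      using one_intersecting_meet_ex[OF F A(1) that(1)] by blast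
    then show ?thesis
      unfolding f_def by (rule someI_ex)
  qed
  have "inj_on f {B \<in> F. x \<in> B}"
  proof (rule inj_onI)
    fix B B'
    assume *: "B \<in> {B \<in> F. x \<in> B}" "B' \<in> {B \<in> F. x \<in> B}" "f B = f B'"
    show "B = B'"
    proof (rule ccontr)
      assume "B \<noteq> B'"
      then have "x = f B"
        using one_intersecting_meet_unique[OF F, of B B' x "f B"] * f[of B] f[of B'] by simp
      then show False
        using * f[of B] A by auto
    qed
  qed
  moreover have "f ` {B \<in> F. x \<in> B} \<subseteq> A"
    using f by blast
  moreover have "finite A" "card A = k"
    using F A unfolding one_intersecting_def by auto
  ultimately show ?thesis
    using card_inj_on_le[of f "{B \<in> F. x \<in> B}" A] by simp
qed

text \<open>Fix a member \<open>A\<close>. Every other member passes through one of the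
  \<open>k\<close> points of \<open>A\<close>, and each of these points lies on at most
  \<open>k - 1\<close> members besides \<open>A\<close>. Projective planes of order
  \<open>k - 1\<close> attain the bound.\<close>

lemma one_intersecting_card_le:
  assumes F: "one_intersecting k F" and no_common: "\<And>x. \<exists>B\<in>F. x \<notin> B"
  shows "card F \<le> k * (k - 1) + 1"
proof -
  obtain A where A: "A \<in> F"
    using no_common by blast
  have fin: "finite F" "finite A" "card A = k"
    using F A unfolding one_intersecting_def by auto
  have "F \<subseteq> insert A (\<Union>x\<in>A. {B \<in> F. x \<in> B} - {A})"
    using one_intersecting_meet_ex[OF F A] by blast
  then have "card F \<le> card (insert A (\<Union>x\<in>A. {B \<in> F. x \<in> B} - {A}))"
    using fin by (intro card_mono) auto
  also have "\<dots> \<le> card (\<Union>x\<in>A. {B \<in> F. x \<in> B} - {A}) + 1"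
    by (rule card_insert_le_m1) simp_all
  also have "card (\<Union>x\<in>A. {B \<in> F. x \<in> B} - {A}) \<le> (\<Sum>x\<in>A. card ({B \<in> F. x \<in> B} - {A}))"
    using fin by (intro card_UN_le)
  also have "\<dots> \<le> (\<Sum>x\<in>A. k - 1)"
  proof (rule sum_mono)
    fix x assume x: "x \<in> A"
    \<comment> \<open>The degree bound needs a member avoiding \<open>x\<close>; \<open>A\<close>
      contains \<open>x\<close>, so the member comes from \<open>no_common\<close>.\<close>
    have "card {B \<in> F. x \<in> B} \<le> k"
      using no_common[of x] one_intersecting_degree_le[OF F] by blast
    moreover have "card ({B \<in> F. x \<in> B} - {A}) = card {B \<in> F. x \<in> B} - 1"
      using A x by (intro card_Diff_singleton) auto
    ultimately show "card ({B \<in> F. x \<in> B} - {A}) \<le> k - 1"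
      by simp
  qed
  finally show ?thesis
    using fin by simp
qed

text \<open>With \<open>r x\<close> the number of members through \<open>x\<close>, double counting
  gives f * k for the sum of the \<open>r x\<close> and f * (f + k - 1) for the sum of their
  squares, where f is the size of \<open>F\<close>. Cauchy-Schwarz over \<open>U\<close> then yields
  the bound. The term \<open>card U\<close> stands on the left to avoid subtraction in the
  naturals.\<close>

lemma one_intersecting_cauchy_schwarz:
  assumes F: "one_intersecting k F" and "F \<noteq> {}" and U: "\<Union>F \<subseteq> U" "finite U"
  shows "card F * k\<^sup>2 + card U \<le> card U * (card F + k)"
proof -
  define r :: "'a \<Rightarrow> real" where "r x = (\<Sum>B\<in>F. of_bool (x \<in> B))" for x
  have fin: "finite F" "\<And>B. B \<in> F \<Longrightarrow> finite B \<and> card B = k"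
    using F unfolding one_intersecting_def by auto
  have card_eq: "(\<Sum>x\<in>U. of_bool (x \<in> B)) = real (card B)" if "B \<subseteq> U" for B
    using that U by (simp add: Int_absorb1 flip: of_bool_def sum.inter_filter)
  have "(\<Sum>x\<in>U. r x) = (\<Sum>B\<in>F. \<Sum>x\<in>U. of_bool (x \<in> B))"
    unfolding r_def by (rule sum.swap)
  also have "\<dots> = (\<Sum>B\<in>F. real k)"
    using fin U by (intro sum.cong refl, subst card_eq) auto
  finally have sum_r: "(\<Sum>x\<in>U. r x) = card F * k"
    by simp
  have "(\<Sum>x\<in>U. (r x)\<^sup>2) = (\<Sum>x\<in>U. \<Sum>A\<in>F. \<Sum>B\<in>F. of_bool (x \<in> A \<inter> B))"
    unfolding r_def power2_eq_square sum_product by (intro sum.cong refl) simp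
  also have "\<dots> = (\<Sum>A\<in>F. \<Sum>x\<in>U. \<Sum>B\<in>F. of_bool (x \<in> A \<inter> B))"
    by (rule sum.swap)
  also have "\<dots> = (\<Sum>A\<in>F. \<Sum>B\<in>F. \<Sum>x\<in>U. of_bool (x \<in> A \<inter> B))"
    by (intro sum.cong refl sum.swap)
  also have "\<dots> = (\<Sum>A\<in>F. \<Sum>B\<in>F. real (card (A \<inter> B)))"
    using U by (intro sum.cong refl card_eq) auto
  also have "\<dots> = (\<Sum>A\<in>F. real k + (\<Sum>B\<in>F - {A}. 1))"
  proof (rule sum.cong[OF refl])
    fix A assume A: "A \<in> F"
    have "(\<Sum>B\<in>F. real (card (A \<inter> B))) = real (card (A \<inter> A)) + (\<Sum>B\<in>F - {A}. real (card (A \<inter> B)))"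
      using A fin by (subst sum.remove[of F A]) auto
    also have "(\<Sum>B\<in>F - {A}. real (card (A \<inter> B))) = (\<Sum>B\<in>F - {A}. 1)"
      using A F unfolding one_intersecting_def by (intro sum.cong) auto
    finally show "(\<Sum>B\<in>F. real (card (A \<inter> B))) = real k + (\<Sum>B\<in>F - {A}. 1)"
      using A fin by simp
  qed
  \<comment> \<open>\<open>F\<close> is nonempty, so the truncated subtraction in the size of
    \<open>F - {A}\<close> agrees with the real one.\<close>
  also have "\<dots> = (\<Sum>A\<in>F. real k + real (card F) - 1)"
    using fin card_gt_0_iff[of F] by (intro sum.cong) (auto simp: of_nat_diff Suc_le_eq)
  finally have sum_r2: "(\<Sum>x\<in>U. (r x)\<^sup>2) = card F * (real k + real (card F) - 1)"
    by simp
  have "(card F * k)\<^sup>2 \<le> card U * (card F * (real k + real (card F) - 1))"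
    using sum_squared_le_sum_of_squares[of r U] U unfolding sum_r sum_r2 by (simp add: mult.commute)
  then have "real (card F) * (card F * k\<^sup>2) \<le> card F * (card U * (real k + real (card F) - 1))"
    by (simp add: power2_eq_square algebra_simps)
  then have "card F * real k ^ 2 \<le> card U * (real k + real (card F) - 1)"
    using fin \<open>F \<noteq> {}\<close> by (simp add: card_gt_0_iff)
  then have "real (card F * k\<^sup>2 + card U) \<le> real (card U * (card F + k))"
    by (simp add: algebra_simps)
  then show ?thesis
    unfolding of_nat_le_iff .
qed

text \<open>A common point would give 8 * \<open>card F\<close> \<le> 90, hence at most 11 members;
  otherwise 9 * 8 + 1 = 73 is the bound.\<close>

lemma one_intersecting_9_card_le:
  assumes "one_intersecting 9 F" "card (\<Union>F) \<le> 90"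
  shows "card F \<le> 73"
proof (cases "\<exists>x. \<forall>B\<in>F. x \<in> B")
  case True
  then show ?thesis
    using one_intersecting_sunflower_card[OF assms(1)] assms(2) by fastforce
next
  case False
  then show ?thesis
    using one_intersecting_card_le[OF assms(1)] by auto
qed

text \<open>On 67 points Cauchy-Schwarz gives 81 f \<le> 67 (f + 8), so f \<le> 38; on 26 points it
  gives 81 f \<le> 26 (f + 8), so f \<le> 3.\<close>

lemma one_intersecting_9_card_Union:
  assumes "one_intersecting 9 F"
  shows "card F \<ge> 39 \<Longrightarrow> card (\<Union>F) \<ge> 68"
    and "card F \<ge> 4 \<Longrightarrow> card (\<Union>F) \<ge> 27"
proof -
  have fin: "finite (\<Union>F)"
    using assms unfolding one_intersecting_def by blast
  have le: "card F * 81 \<le> card (\<Union>F) * (card F + 8)" if "F \<noteq> {}"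
    using one_intersecting_cauchy_schwarz[OF assms that order_refl fin] by (simp add: algebra_simps)
  show "card (\<Union>F) \<ge> 68" if "card F \<ge> 39"
  proof (rule ccontr)
    assume "\<not> card (\<Union>F) \<ge> 68"
    then have "card (\<Union>F) * (card F + 8) \<le> 67 * (card F + 8)"
      by (intro mult_right_mono) auto
    moreover have "F \<noteq> {}"
      using that by auto
    ultimately show False
      using le that by fastforce
  qed
  show "card (\<Union>F) \<ge> 27" if "card F \<ge> 4"
  proof (rule ccontr)
    assume "\<not> card (\<Union>F) \<ge> 27"
    then have "card (\<Union>F) * (card F + 8) \<le> 26 * (card F + 8)"
      by (intro mult_right_mono) auto
    moreover have "F \<noteq> {}"
      using that by auto
    ultimately show False
      using le that by fastforce
  qed
qed

text \<open>A family with 39 members leaves at most 90 - 68 = 22 points, too few for 4 members of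
  the other. Both cases end at the same value: 38 + 38 = 73 + 3 = 76.\<close>

lemma one_intersecting_9_pair_card_le:
  fixes F G :: "'a::finite set set"
  assumes F: "one_intersecting 9 F" and G: "one_intersecting 9 G"
    and disjoint: "\<Union>F \<inter> \<Union>G = {}" and "CARD('a) = 90"
  shows "card F + card G \<le> 76"
proof -
  have "card (\<Union>F) + card (\<Union>G) = card (\<Union>F \<union> \<Union>G)"
    using disjoint by (intro card_Un_disjoint[symmetric]) auto
  also have "\<dots> \<le> 90"
    unfolding assms(4)[symmetric] by (intro card_mono) auto
  finally have "card (\<Union>F) + card (\<Union>G) \<le> 90" .
  then show ?thesis
    using one_intersecting_9_card_le[OF F] one_intersecting_9_card_le[OF G]
      one_intersecting_9_card_Union[OF F] one_intersecting_9_card_Union[OF G]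
    by linarith
qed

section \<open>Binary vectors and their supports\<close>

definition support :: "'n::finite binary_vector \<Rightarrow> 'n set" where
  "support v = {i. v $ i \<noteq> 0}"

lemma weight_eq_card_support: "weight v = card (support v)"
  by (simp add: weight_def support_def)

lemma inj_support: "inj (support :: 'n::finite binary_vector \<Rightarrow> 'n set)"
proof (rule injI)
  fix v w :: "'n binary_vector"
  assume "support v = support w"
  then have "v $ i \<noteq> 0 \<longleftrightarrow> w $ i \<noteq> 0" for i
    unfolding support_def by blast
  then show "v = w"
    unfolding vec_eq_iff by (metis bit_not_zero_iff)
qed

lemma weight_add: "weight (v + w) + 2 * card (support v \<inter> support w) = weight v + weight w"
proof -
  have eq: "support (v + w) = (support v - support w) \<union> (support w - support v)"
    unfolding support_def by auto
  have "weight (v + w) = card (support v - support w) + card (support w - support v)"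
    unfolding weight_eq_card_support eq by (intro card_Un_disjoint) auto
  moreover have "card (support v) = card (support v - support w) + card (support v \<inter> support w)"
    by (subst card_Un_disjoint[symmetric]) (auto intro: arg_cong[where f = card])
  moreover have "card (support w) = card (support w - support v) + card (support v \<inter> support w)"
    by (subst card_Un_disjoint[symmetric]) (auto intro: arg_cong[where f = card])
  ultimately show ?thesis
    by (simp add: weight_eq_card_support)
qed

lemma finite_binary_vector_set [simp]: "finite (A :: 'n::finite binary_vector set)"
  by (rule inj_on_finite[OF inj_on_subset[OF inj_support]]) auto

definition inner_prod :: "'n::finite binary_vector \<Rightarrow> 'n binary_vector \<Rightarrow> bit" where
  "inner_prod v w = (\<Sum>i\<in>UNIV. v $ i * w $ i)"

lemma inner_prod_add_left: "inner_prod (u + v) w = inner_prod u w + inner_prod v w"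
  unfolding inner_prod_def vector_add_component distrib_right sum.distrib ..

lemma inner_prod_add_right: "inner_prod u (v + w) = inner_prod u v + inner_prod u w"
  unfolding inner_prod_def vector_add_component distrib_left sum.distrib ..

lemma inner_prod_eq_0_iff: "inner_prod v w = 0 \<longleftrightarrow> even (card (support v \<inter> support w))"
proof -
  have "inner_prod v w = (\<Sum>i\<in>UNIV. of_bool (i \<in> support v \<inter> support w))"
    unfolding inner_prod_def support_def by (intro sum.cong refl) auto
  also have "\<dots> = of_nat (card (support v \<inter> support w))"
    by (simp add: Int_def)
  finally show ?thesis
    by (cases "even (card (support v \<inter> support w))") (auto elim!: evenE oddE)
qed

lemma mem_dual_code_iff: "v \<in> dual_code C \<longleftrightarrow> (\<forall>c\<in>C. inner_prod v c = 0)"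
  unfolding dual_code_def inner_prod_def by simp

section \<open>Self-dual codes and their shadows\<close>

lemma dual_code_add:
  assumes "v \<in> dual_code C" "w \<in> dual_code C"
  shows "v + w \<in> dual_code C"
  using assms unfolding mem_dual_code_iff inner_prod_add_left by simp

lemma self_dual_add:
  assumes "self_dual C" "v \<in> C" "w \<in> C"
  shows "v + w \<in> C"
  using assms dual_code_add[of v C w] unfolding self_dual_def by simp

lemma self_dual_even_inter:
  assumes "self_dual C" "v \<in> C" "w \<in> C"
  shows "even (card (support v \<inter> support w))"
proof -
  have "v \<in> dual_code C"
    using assms unfolding self_dual_def by simp
  then show ?thesis
    using assms(3) by (simp add: mem_dual_code_iff inner_prod_eq_0_iff)
qed

lemma self_dual_even_weight:
  assumes "self_dual C" "v \<in> C"
  shows "even (weight v)"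
  using self_dual_even_inter[OF assms(1,2,2)] by (simp add: weight_eq_card_support)

text \<open>The overlap of two codewords is even, so twice the overlap vanishes modulo 4.\<close>

lemma self_dual_weight_add_mod_4:
  assumes "self_dual C" "v \<in> C" "w \<in> C"
  shows "weight (v + w) mod 4 = (weight v + weight w) mod 4"
proof -
  obtain m where "card (support v \<inter> support w) = 2 * m"
    using self_dual_even_inter[OF assms] by (elim evenE)
  then have "weight v + weight w = weight (v + w) + m * 4"
    using weight_add[of v w] by linarith
  then show ?thesis
    by (metis mod_mult_self1)
qed

text \<open>Codeword weights are even, and half the weight modulo 2 is additive on \<open>C\<close>;
  the doubly even subcode is the kernel of this map.\<close>

lemma self_dual_add_doubly_even_iff:
  assumes "self_dual C" "v \<in> C" "w \<in> C"
  shows "weight (v + w) mod 4 = 0 \<longleftrightarrow> (weight v mod 4 = 0 \<longleftrightarrow> weight w mod 4 = 0)"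
proof -
  obtain a b where ab: "weight v = 2 * a" "weight w = 2 * b"
    using self_dual_even_weight assms by (meson evenE)
  have mod_4: "2 * n mod 4 = 0 \<longleftrightarrow> even n" for n :: nat
    using mod_mult_mult1[of 2 n 2] by (simp add: even_iff_mod_2_eq_zero)
  have "weight (v + w) mod 4 = 2 * (a + b) mod 4"
    using self_dual_weight_add_mod_4[OF assms] ab by simp
  then show ?thesis
    by (simp only: ab mod_4 even_add)
qed

text \<open>As \<open>x\<close> lies outside \<open>C\<close>, which is its own dual, some codeword
  \<open>d\<close> is not orthogonal to \<open>x\<close>, and \<open>d\<close> cannot be doubly
  even. If \<open>c\<close> is not doubly even either, then \<open>c + d\<close> is, so
  \<open>x\<close> is orthogonal to \<open>c + d\<close> and has the same nonzero product with
  \<open>c\<close> as with \<open>d\<close>.\<close>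

lemma inner_prod_shadow_eq_0_iff:
  assumes C: "self_dual C" and x: "x \<in> shadow C" and c: "c \<in> C"
  shows "inner_prod x c = 0 \<longleftrightarrow> weight c mod 4 = 0"
proof -
  have orth: "inner_prod x c' = 0" if "c' \<in> C" "weight c' mod 4 = 0" for c'
    using x that unfolding shadow_def doubly_even_subcode_def by (simp add: mem_dual_code_iff)
  have "x \<notin> dual_code C"
    using x C unfolding shadow_def self_dual_def by blast
  then obtain d where d: "d \<in> C" "inner_prod x d \<noteq> 0"
    unfolding mem_dual_code_iff by blast
  have "inner_prod x c \<noteq> 0" if "weight c mod 4 \<noteq> 0"
  proof -
    have "weight d mod 4 \<noteq> 0"
      using orth d by blast
    then have "weight (c + d) mod 4 = 0"
      using self_dual_add_doubly_even_iff[OF C c d(1)] that by simp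
    then have "inner_prod x (c + d) = 0"
      by (intro orth self_dual_add[OF C c d(1)])
    then show ?thesis
      using d(2) unfolding inner_prod_add_right by auto
  qed
  then show ?thesis
    using orth[OF c] by (cases "weight c mod 4 = 0") simp_all
qed

text \<open>Both vectors have the same inner product with every codeword, so their sum is orthogonal
  to \<open>C\<close>.\<close>

lemma shadow_add:
  assumes C: "self_dual C" and "x \<in> shadow C" "y \<in> shadow C"
  shows "x + y \<in> C"
proof -
  have "inner_prod (x + y) c = 0" if "c \<in> C" for c
  proof -
    have "inner_prod x c = inner_prod y c"
      using inner_prod_shadow_eq_0_iff[OF C assms(2) that]
        inner_prod_shadow_eq_0_iff[OF C assms(3) that]
      by (cases "inner_prod x c") auto
    then show ?thesis
      unfolding inner_prod_add_left by simp
  qed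
  then have "x + y \<in> dual_code C"
    unfolding mem_dual_code_iff by blast
  then show ?thesis
    using C unfolding self_dual_def by blast
qed

lemma min_weight_le:
  assumes "v \<in> A" "v \<noteq> 0"
  shows "min_weight A \<le> weight v"
  unfolding min_weight_def using assms by (intro Min_le) auto

lemma coeff_weight_enumerator:
  "coeff (weight_enumerator A) j = int (card {v \<in> (A :: 'n::finite binary_vector set). weight v = j})"
proof -
  have "card {v \<in> A. weight v = j} = 0" if "j > CARD('n)"
  proof -
    have "weight v \<le> CARD('n)" for v :: "'n binary_vector"
      unfolding weight_def by (intro card_mono) auto
    then have "{v \<in> A. weight v = j} = {}"
      using that by (auto simp: not_le[symmetric])
    then show ?thesis
      by (simp only: card.empty)
  qed
  then show ?thesis
    unfolding weight_enumerator_def by (auto simp: coeff_sum not_le)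
qed

lemma card_weight_9_shadow_le:
  fixes C :: "'n::finite binary_vector set"
  assumes C: "self_dual C" and min: "min_weight C = 16" and "CARD('n) = 90"
  shows "card {v \<in> shadow C. weight v = 9} \<le> 76"
proof (cases "{v \<in> shadow C. weight v = 9} = {}")
  case True
  show ?thesis
    unfolding True by simp
next
  case False
  define S where "S = {v \<in> shadow C. weight v = 9}"
  have "S \<noteq> {}"
    using False unfolding S_def .
  then obtain z where z: "z \<in> S"
    by (meson all_not_in_conv)
  have add_C: "x + y \<in> C" if "x \<in> S" "y \<in> S" for x y
    using that unfolding S_def by (intro shadow_add[OF C]) auto
  \<comment> \<open>The sum has weight 18 minus twice the overlap. Being a nonzero codeword it has
    weight at least 16, so only 18 (overlap 0) and 16 (overlap 1) remain, and the residue modulo 4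
    tells them apart.\<close>
  have inter: "card (support x \<inter> support y) = (if weight (x + y) mod 4 = 0 then 1 else 0)"
    if "x \<in> S" "y \<in> S" "x \<noteq> y" for x y
  proof -
    have "x + y \<noteq> 0"
    proof
      assume "x + y = 0"
      moreover have "y + y = 0"
        by (simp add: vec_eq_iff)
      ultimately show False
        using that(3) by (metis add_right_cancel)
    qed
    then have "weight (x + y) \<ge> 16"
      using min_weight_le[of "x + y" C] add_C that min by auto
    moreover have "weight (x + y) + 2 * card (support x \<inter> support y) = 18"
      using weight_add[of x y] that unfolding S_def by simp
    ultimately have "card (support x \<inter> support y) = 0 \<and> weight (x + y) = 18 \<or>
        card (support x \<inter> support y) = 1 \<and> weight (x + y) = 16"
      by arith
    then show ?thesis
      by auto
  qed
  \<comment> \<open>\<open>P\<close> selects the vectors of \<open>S\<close> in the same coset of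
    the doubly even subcode as the reference vector \<open>z\<close>; the sum of two vectors is
    doubly even exactly when \<open>P\<close> agrees on them.\<close>
  define P where "P x \<longleftrightarrow> weight (z + x) mod 4 = 0" for x
  have same_class: "weight (x + y) mod 4 = 0 \<longleftrightarrow> (P x \<longleftrightarrow> P y)"
    if "x \<in> S" "y \<in> S" for x y
  proof -
    have "z + z = 0"
      by (simp add: vec_eq_iff)
    then have "(z + x) + (z + y) = x + y"
      by (metis add.assoc add.commute add_0)
    then show ?thesis
      using self_dual_add_doubly_even_iff[OF C add_C[OF z that(1)] add_C[OF z that(2)]]
      unfolding P_def by simp
  qed
  define F where "F = support ` {x \<in> S. P x}"
  define G where "G = support ` {x \<in> S. \<not> P x}"
  have wt: "card (support x) = 9" if "x \<in> S" for x
    using that unfolding S_def weight_eq_card_support by simp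
  have one_intersecting: "one_intersecting 9 (support ` T)"
    if "T \<subseteq> S" and T: "\<And>x y. x \<in> T \<Longrightarrow> y \<in> T \<Longrightarrow> weight (x + y) mod 4 = 0" for T
    unfolding one_intersecting_def
  proof (intro conjI ballI impI)
    fix A B assume "A \<in> support ` T" "B \<in> support ` T" "A \<noteq> B"
    then obtain x y where "x \<in> T" "y \<in> T" "x \<noteq> y" "A = support x" "B = support y"
      by blast
    then show "card (A \<inter> B) = 1"
      using inter[of x y] T[of x y] \<open>T \<subseteq> S\<close> by (simp add: subset_iff)
  qed (use wt \<open>T \<subseteq> S\<close> in auto)
  have F: "one_intersecting 9 F"
    unfolding F_def
  proof (rule one_intersecting)
    fix x y assume "x \<in> {x \<in> S. P x}" "y \<in> {x \<in> S. P x}"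
    then show "weight (x + y) mod 4 = 0"
      using same_class[of x y] by simp
  qed auto
  have G: "one_intersecting 9 G"
    unfolding G_def
  proof (rule one_intersecting)
    fix x y assume "x \<in> {x \<in> S. \<not> P x}" "y \<in> {x \<in> S. \<not> P x}"
    then show "weight (x + y) mod 4 = 0"
      using same_class[of x y] by simp
  qed auto
  have "support x \<inter> support y = {}"
    if "x \<in> S" "P x" "y \<in> S" "\<not> P y" for x y
  proof -
    have "x \<noteq> y"
      using that by metis
    then show ?thesis
      using inter[of x y] same_class[of x y] that by simp
  qed
  then have disjoint: "\<Union>F \<inter> \<Union>G = {}"
    unfolding F_def G_def by blast
  have "card S = card {x \<in> S. P x} + card {x \<in> S. \<not> P x}"
    by (subst card_Un_disjoint[symmetric]) (auto intro: arg_cong[where f = card])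
  also have "\<dots> = card F + card G"
    unfolding F_def G_def card_image[OF inj_on_subset[OF inj_support subset_UNIV]] ..
  also have "\<dots> \<le> 76"
    using one_intersecting_9_pair_card_le[OF F G disjoint] assms(3) by simp
  finally show ?thesis
    unfolding S_def .
qed

theorem proposition6:
  fixes \<alpha> \<beta> :: int and C :: "'n::finite binary_vector set"
  assumes "linear_code 90 45 16 C"
    and "singly_even_self_dual C"
    and "extremal C"
    and "min_weight (shadow C) \<ge> 9"
    and "\<exists>R. weight_enumerator C =
           1 + monom (9180 + 8 * \<beta>) 16 + monom (- 512 * \<alpha> - 24 * \<beta> + 224360) 18
             + monom 1 19 * R"
    and "\<exists>R. weight_enumerator (shadow C) =
           monom \<alpha> 9 + monom (\<beta> - 18 * \<alpha>) 13 + monom (112320 + 153 * \<alpha> - 16 * \<beta>) 17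
             + monom 1 18 * R"
  shows "0 \<le> \<alpha> \<and> \<alpha> \<le> 76"
proof -
  obtain R where "weight_enumerator (shadow C) =
      monom \<alpha> 9 + monom (\<beta> - 18 * \<alpha>) 13 + monom (112320 + 153 * \<alpha> - 16 * \<beta>) 17 + monom 1 18 * R"
    using assms(6) by blast
  \<comment> \<open>All other terms have degree at least 13. Being a count of vectors, the
    coefficient is also nonnegative, which gives the lower bound.\<close>
  then have "\<alpha> = coeff (weight_enumerator (shadow C)) 9"
    by (simp add: coeff_monom_mult)
  then have "\<alpha> = int (card {v \<in> shadow C. weight v = 9})"
    unfolding coeff_weight_enumerator .
  moreover have "card {v \<in> shadow C. weight v = 9} \<le> 76"
    using assms(1,2) unfolding linear_code_def singly_even_self_dual_def
    by (intro card_weight_9_shadow_le) auto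
  ultimately show ?thesis
    by simp
qed

end
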